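(* Let $K$ be a field of characteristic zero, let $n\leq 7$ and let $S$ be a maximal admissible subset of $\Delta^+$. Let $\mathfrak p_S\subset\mathfrak g=\mathfrak{ut}(n,K)$ be the linear subspace spanned by the basis vectors $y_\eta$ for which the root $\eta$ corresponds to one of the symbols $+$, $\otimes$, $\square$ or $\bullet$ in the diagram $D(S)$ (i.e. not to the symbol $-$). If it is not the case that $n=7$ and $S=S^\circ:=\{\alpha_{14},\alpha_{25},\alpha_{37},\alpha_{47},\alpha_{46},\alpha_{56}\}$, then $\mathfrak p_S$ is a polarization of all linear forms $f_{S,c}$ (where $(S,c)$ runs over the maximal admissible pairs with first component $S$). If $n=7$ and $S=S^\circ$, then a polarization of all the forms $f_{S,c}$ is obtained by replacing $y_{54}$ by $y_{75}$ in the set of those basis vectors $y_\eta$, $\eta\in\Delta^+$, for which $\eta$ corresponds to one of the symbols $+$, $\otimes$, $\square$ or $\bullet$ in the diagram $D(S^\circ)$, and taking the linear span of the resulting set.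
   Context: $\mathfrak g=\mathfrak{ut}(n,K)$ is the Lie algebra of strictly lower triangular $n\times n$ matrices, with basis the matrix units $y_{ij}$, $i>j$. $\Delta^+=\{\alpha_{ji}=\varepsilon_j-\varepsilon_i: 1\le j<i\le n\}$; for $\xi=\alpha_{ji}$ write $y_\xi=y_{ij}$. Order: $\alpha_{ji}>\alpha_{ts}$ iff $j<t$, or $j=t$ and $i>s$. $A\subset\Delta^+$ is additive if $\alpha,\beta\in A$, $\alpha+\beta\in\Delta^+$ imply $\alpha+\beta\in A$. For additive $A$ and $\xi\in A$ let $C(\xi,A)=\{\gamma\in A:\ \xi-\gamma\in A\}=C_+(\xi,A)\sqcup C_-(\xi,A)$, where $\gamma\in C_+$ if $\gamma>\xi-\gamma$ and $\gamma\in C_-$ if $\gamma<\xi-\gamma$; the set $A(\xi)=A\setminus C(\xi,A)$ is again additive. A subset $S=\{\xi_1>\dots>\xi_k\}\subset\Delta^+$ is admissible if, with $A_1=\Delta^+$ and $A_{i+1}=A_i(\xi_i)$, one has $\xi_i\in A_i$ for all $i$. Put $A(S)=A_{k+1}$, $M(S)=A(S)\setminus S$. Write $S=S_\otimes\sqcup S_\square$, where $\xi_i\in S_\otimes$ if $C(\xi_i,A_i)\neq\emptyset$ and $\xi_i\in S_\square$ if $C(\xi_i,A_i)=\emptyset$. The diagram $D(S)$ is the $n\times n$ table whose entry $(i,j)$, $i>j$, carries: $\otimes$ if $\alpha_{ji}\in S_\otimes$; $\square$ if $\alpha_{ji}\in S_\square$; $\bullet$ if $\alpha_{ji}\in M(S)$;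 $+$ (resp. $-$) if $\alpha_{ji}\in C_+(\xi_r,A_r)$ (resp. $C_-(\xi_r,A_r)$) for some $r$. An admissible $S$ is maximal if $S_\square$ is maximal by inclusion among the sets $S'_\square$ for admissible $S'$ with $S'_\otimes=S_\otimes$. A maximal admissible pair is a pair $(S,c)$ with $S$ maximal admissible and $c:S\to K$ a map with $c(\xi)\ne0$ for $\xi\in S_\otimes$. Extend $c$ to $A(S)$ by $c(\gamma)=0$ for $\gamma\in M(S)$. The canonical form $f_{S,c}\in\mathfrak g^*$ is defined by $f_{S,c}(y_\gamma)=c(\gamma)$ for $\gamma\in A(S)$ and $f_{S,c}(y_\gamma)=0$ for $\gamma\in\Delta^+\setminus A(S)$. For a Lie algebra $\mathcal G$ and $f\in\mathcal G^*$, a subalgebra $\mathfrak p\subset\mathcal G$ is a polarization of $f$ if $\mathfrak p$ is a maximal isotropic subspace for the skew-symmetric bilinear form $f([x,y])$ on $\mathcal G$. *)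

theory Defs
  imports "Jordan_Normal_Form.VS_Connect"
begin

text \<open>
  The pair \<open>(j, i)\<close> with \<open>1 \<le> j < i \<le> n\<close> stands for the root
  \<open>\<alpha>\<^sub>j\<^sub>i = \<epsilon>\<^sub>j - \<epsilon>\<^sub>i\<close>, whose value as an integer vector is \<open>root_vec (j, i)\<close>.
\<close>

type_synonym posroot = "nat \<times> nat"

definition pos_roots :: "nat \<Rightarrow> posroot set" where
  "pos_roots n = {(j, i). 1 \<le> j \<and> j < i \<and> i \<le> n}"

definition eps :: "nat \<Rightarrow> nat \<Rightarrow> int" where
  "eps k = (\<lambda>l. if l = k then 1 else 0)"

definition root_vec :: "posroot \<Rightarrow> nat \<Rightarrow> int" where
  "root_vec = (\<lambda>(j, i). eps j - eps i)"

definition root_gt :: "posroot \<Rightarrow> posroot \<Rightarrow> bool" where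
  "root_gt = (\<lambda>(j, i) (t, s). j < t \<or> (j = t \<and> i > s))"

lemma root_vec_inj:
  assumes "\<alpha> \<in> pos_roots n" "\<beta> \<in> pos_roots n" "root_vec \<alpha> = root_vec \<beta>"
  shows "\<alpha> = \<beta>"
proof -
  have pos: "{l. root_vec (j, i) l = 1} = {j}" and neg: "{l. root_vec (j, i) l = -1} = {i}"
    if "(j, i) \<in> pos_roots n" for j i
    using that by (auto simp: pos_roots_def root_vec_def eps_def split: if_splits)
  show ?thesis
    using assms pos neg by (cases \<alpha>; cases \<beta>) (metis singleton_inject)
qed

definition C_plus :: "posroot \<Rightarrow> posroot set \<Rightarrow> posroot set" where
  "C_plus \<xi> A = {\<gamma> \<in> A. \<exists>\<delta> \<in> A. root_vec \<xi> - root_vec \<gamma> = root_vec \<delta> \<and> root_gt \<gamma> \<delta>}"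

definition C_minus :: "posroot \<Rightarrow> posroot set \<Rightarrow> posroot set" where
  "C_minus \<xi> A = {\<gamma> \<in> A. \<exists>\<delta> \<in> A. root_vec \<xi> - root_vec \<gamma> = root_vec \<delta> \<and> root_gt \<delta> \<gamma>}"

definition C_set :: "posroot \<Rightarrow> posroot set \<Rightarrow> posroot set" where
  "C_set \<xi> A = {\<gamma> \<in> A. \<exists>\<delta> \<in> A. root_vec \<xi> - root_vec \<gamma> = root_vec \<delta>}"

text \<open>The decreasing enumeration \<open>\<xi>\<^sub>1 > \<dots> > \<xi>\<^sub>k\<close> of a finite set of roots.\<close>

definition desc_list :: "posroot set \<Rightarrow> posroot list" where
  "desc_list S = (THE xs. set xs = S \<and> sorted_wrt root_gt xs)"

lemma desc_list_ex1:
  assumes "finite S"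
  shows "\<exists>!xs. set xs = S \<and> sorted_wrt root_gt xs"
proof -
  interpret L: linorder "\<lambda>a b. a = b \<or> root_gt a b" root_gt
    by unfold_locales (auto simp: root_gt_def)
  show ?thesis
    using L.sorted_list_of_set.finite_set_strict_sorted[OF assms] L.strict_sorted_equal
    by metis
qed

text \<open>
  Lists are indexed from 0, so \<open>desc_list S ! r\<close> is \<open>\<xi>\<close> with index \<open>r + 1\<close>, and
  \<open>A_stage n S r\<close> is \<open>A\<close> with index \<open>r + 1\<close>.
\<close>

primrec A_stage :: "nat \<Rightarrow> posroot set \<Rightarrow> nat \<Rightarrow> posroot set" where
  "A_stage n S 0 = pos_roots n"
| "A_stage n S (Suc r) = A_stage n S r - C_set (desc_list S ! r) (A_stage n S r)"

definition admissible :: "nat \<Rightarrow> posroot set \<Rightarrow> bool" where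
  "admissible n S \<longleftrightarrow> S \<subseteq> pos_roots n \<and> (\<forall>r < card S. desc_list S ! r \<in> A_stage n S r)"

definition A_of :: "nat \<Rightarrow> posroot set \<Rightarrow> posroot set" where
  "A_of n S = A_stage n S (card S)"

definition M_of :: "nat \<Rightarrow> posroot set \<Rightarrow> posroot set" where
  "M_of n S = A_of n S - S"

definition S_otimes :: "nat \<Rightarrow> posroot set \<Rightarrow> posroot set" where
  "S_otimes n S = {desc_list S ! r | r. r < card S \<and> C_set (desc_list S ! r) (A_stage n S r) \<noteq> {}}"

definition S_box :: "nat \<Rightarrow> posroot set \<Rightarrow> posroot set" where
  "S_box n S = {desc_list S ! r | r. r < card S \<and> C_set (desc_list S ! r) (A_stage n S r) = {}}"

definition maximal_admissible :: "nat \<Rightarrow> posroot set \<Rightarrow> bool" where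
  "maximal_admissible n S \<longleftrightarrow> admissible n S \<and>
     (\<forall>S'. admissible n S' \<and> S_otimes n S' = S_otimes n S \<and> S_box n S \<subseteq> S_box n S'
        \<longrightarrow> S_box n S' = S_box n S)"

text \<open>Only the values of \<open>c\<close> on \<open>S\<close> matter.\<close>

definition maximal_admissible_pair ::
    "nat \<Rightarrow> posroot set \<Rightarrow> (posroot \<Rightarrow> 'a :: field) \<Rightarrow> bool" where
  "maximal_admissible_pair n S c \<longleftrightarrow> maximal_admissible n S \<and> (\<forall>\<xi> \<in> S_otimes n S. c \<xi> \<noteq> 0)"

datatype diagram_symbol = Otimes | Box | Bullet | Plus | Minus

text \<open>
  \<open>diagram n S s\<close> is the set of places \<open>(i, j)\<close> (row, column) of the table \<open>D(S)\<close>
  that carry the symbol \<open>s\<close>; the place \<open>(i, j)\<close> belongs to the root \<open>(j, i)\<close>.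
\<close>

fun diagram :: "nat \<Rightarrow> posroot set \<Rightarrow> diagram_symbol \<Rightarrow> (nat \<times> nat) set" where
  "diagram n S Otimes = {(i, j). (j, i) \<in> S_otimes n S}"
| "diagram n S Box = {(i, j). (j, i) \<in> S_box n S}"
| "diagram n S Bullet = {(i, j). (j, i) \<in> M_of n S}"
| "diagram n S Plus = {(i, j). \<exists>r < card S. (j, i) \<in> C_plus (desc_list S ! r) (A_stage n S r)}"
| "diagram n S Minus = {(i, j). \<exists>r < card S. (j, i) \<in> C_minus (desc_list S ! r) (A_stage n S r)}"

definition ut :: "nat \<Rightarrow> 'a :: field mat set" where
  "ut n = {X \<in> carrier_mat n n. \<forall>r < n. \<forall>s < n. r \<le> s \<longrightarrow> X $$ (r, s) = 0}"

definition ut_vs :: "nat \<Rightarrow> ('a :: field, 'a mat) module" where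
  "ut_vs n = (module_mat TYPE('a) n n)\<lparr>carrier := ut n\<rparr>"

definition lie_bracket :: "'a :: field mat \<Rightarrow> 'a mat \<Rightarrow> 'a mat" where
  "lie_bracket X Y = X * Y - Y * X"

text \<open>\<open>y_mat n (j, i)\<close> is the matrix unit \<open>y\<^sub>i\<^sub>j\<close>; matrix entries are indexed from 0.\<close>

definition y_mat :: "nat \<Rightarrow> posroot \<Rightarrow> 'a :: field mat" where
  "y_mat n = (\<lambda>(j, i). mat n n (\<lambda>(r, s). if r = i - 1 \<and> s = j - 1 then 1 else 0))"

definition field_vs :: "('a :: field, 'a) module" where
  "field_vs = \<lparr>carrier = UNIV, mult = (*), one = 1, zero = 0, add = (+), smult = (*)\<rparr>"

definition dual_space :: "('a :: field, 'g) module \<Rightarrow> ('g \<Rightarrow> 'a) set" where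
  "dual_space G = LinearCombinations.module_hom class_ring G field_vs"

text \<open>
  In the following notions \<open>G\<close> is the underlying vector space of a Lie algebra with
  bracket \<open>br\<close>, and \<open>f\<close> is a linear form on it.
\<close>

definition lie_subalgebra ::
    "('a :: field, 'g) module \<Rightarrow> ('g \<Rightarrow> 'g \<Rightarrow> 'g) \<Rightarrow> 'g set \<Rightarrow> bool" where
  "lie_subalgebra G br p \<longleftrightarrow> VectorSpace.subspace class_ring p G \<and> (\<forall>x \<in> p. \<forall>y \<in> p. br x y \<in> p)"

definition isotropic_subspace ::
    "('a :: field, 'g) module \<Rightarrow> ('g \<Rightarrow> 'g \<Rightarrow> 'g) \<Rightarrow> ('g \<Rightarrow> 'a) \<Rightarrow> 'g set \<Rightarrow> bool" where
  "isotropic_subspace G br f W \<longleftrightarrow>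
     VectorSpace.subspace class_ring W G \<and> (\<forall>x \<in> W. \<forall>y \<in> W. f (br x y) = 0)"

definition polarization ::
    "('a :: field, 'g) module \<Rightarrow> ('g \<Rightarrow> 'g \<Rightarrow> 'g) \<Rightarrow> ('g \<Rightarrow> 'a) \<Rightarrow> 'g set \<Rightarrow> bool" where
  "polarization G br f p \<longleftrightarrow>
     lie_subalgebra G br p \<and> isotropic_subspace G br f p \<and>
     (\<forall>W. isotropic_subspace G br f W \<and> p \<subseteq> W \<longrightarrow> W = p)"

text \<open>
  \<open>c\<close> is extended by 0 from \<open>S\<close> to \<open>A(S)\<close>. The canonical form is written out in the
  coordinates of the basis \<open>y\<^sub>\<gamma>\<close>; see \<open>canonical_form_dual\<close> and \<open>canonical_form_y_mat\<close>.
\<close>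

definition c_ext :: "posroot set \<Rightarrow> (posroot \<Rightarrow> 'a :: field) \<Rightarrow> posroot \<Rightarrow> 'a" where
  "c_ext S c \<gamma> = (if \<gamma> \<in> S then c \<gamma> else 0)"

definition canonical_form ::
    "nat \<Rightarrow> posroot set \<Rightarrow> (posroot \<Rightarrow> 'a :: field) \<Rightarrow> 'a mat \<Rightarrow> 'a" where
  "canonical_form n S c X =
     (\<Sum>(j, i) \<in> pos_roots n. (if (j, i) \<in> A_of n S then c_ext S c (j, i) else 0) * X $$ (i - 1, j - 1))"

definition mat_span :: "nat \<Rightarrow> 'a :: field mat set \<Rightarrow> 'a mat set" where
  "mat_span n B = LinearCombinations.module.span class_ring (ut_vs n) B"

definition p_basis :: "nat \<Rightarrow> posroot set \<Rightarrow> 'a :: field mat set" where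
  "p_basis n S = {y_mat n (j, i) | j i. (j, i) \<in> pos_roots n \<and>
     (\<exists>s \<in> {Plus, Otimes, Box, Bullet}. (i, j) \<in> diagram n S s)}"

definition p_space :: "nat \<Rightarrow> posroot set \<Rightarrow> 'a :: field mat set" where
  "p_space n S = mat_span n (p_basis n S)"

definition S_circ :: "posroot set" where
  "S_circ = {(1, 4), (2, 5), (3, 7), (4, 7), (4, 6), (5, 6)}"

lemma finite_pos_roots: "finite (pos_roots n)"
  by (rule finite_subset[of _ "{..n} \<times> {..n}"]) (auto simp: pos_roots_def)

lemma C_set_split:
  assumes "A \<subseteq> pos_roots n"
  shows "C_set \<xi> A = C_plus \<xi> A \<union> C_minus \<xi> A" and "C_plus \<xi> A \<inter> C_minus \<xi> A = {}"
proof -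
  have ne: "\<gamma> \<noteq> \<delta>" if \<gamma>: "\<gamma> \<in> A" and d: "root_vec \<xi> - root_vec \<gamma> = root_vec \<delta>" for \<gamma> \<delta>
  proof
    assume "\<gamma> = \<delta>"
    moreover obtain j i t s where p: "\<xi> = (j, i)" "\<gamma> = (t, s)" by (cases \<xi>; cases \<gamma>) auto
    moreover have "t \<noteq> s" using \<gamma> assms p by (auto simp: pos_roots_def)
    ultimately show False
      using fun_cong[OF d, of t] by (auto simp: root_vec_def eps_def split: if_splits)
  qed
  have total: "root_gt \<gamma> \<delta> \<or> root_gt \<delta> \<gamma>" if "\<gamma> \<noteq> \<delta>" for \<gamma> \<delta>
    using that by (auto simp: root_gt_def split: prod.splits)
  show "C_set \<xi> A = C_plus \<xi> A \<union> C_minus \<xi> A"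
    unfolding C_set_def C_plus_def C_minus_def using ne total by blast
  have asym: "\<not> (root_gt \<gamma> \<delta> \<and> root_gt \<delta> \<gamma>)" for \<gamma> \<delta>
    by (auto simp: root_gt_def split: prod.splits)
  show "C_plus \<xi> A \<inter> C_minus \<xi> A = {}"
  proof (intro equals0I)
    fix \<gamma> assume "\<gamma> \<in> C_plus \<xi> A \<inter> C_minus \<xi> A"
    then obtain \<delta> \<delta>' where d: "\<delta> \<in> A" "\<delta>' \<in> A" "root_gt \<gamma> \<delta>" "root_gt \<delta>' \<gamma>"
        "root_vec \<delta> = root_vec \<delta>'"
      unfolding C_plus_def C_minus_def by auto
    then have "\<delta> = \<delta>'" using root_vec_inj assms by blast
    then show False using d asym by blast
  qed
qed

lemma ut_submodule:
  "submodule class_ring (ut n) (module_mat TYPE('a :: field) n n)"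
  using matrix_vs[where 'a = 'a]
  by (auto simp: submodule_def vectorspace_def module_mat_simps ut_def)

lemma ut_vs_vectorspace: "vectorspace class_ring (ut_vs n :: ('a :: field, 'a mat) module)"
proof -
  interpret V: vectorspace class_ring "module_mat TYPE('a) n n" by (rule matrix_vs)
  show ?thesis
    using V.submodule_is_module[OF ut_submodule] class_field
    by (simp add: ut_vs_def vectorspace_def)
qed

lemma ut_lie_bracket:
  assumes "X \<in> ut n" "Y \<in> ut n"
  shows "lie_bracket X Y \<in> ut n"
proof -
  have cl: "(X * Y) $$ (r, s) = 0" if XY: "X \<in> ut n" "Y \<in> ut n" and rs: "r \<le> s" "s < n"
    for X Y :: "'a mat" and r s
  proof -
    have "(X * Y) $$ (r, s) = (\<Sum>k = 0..<n. X $$ (r, k) * Y $$ (k, s))"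
      using XY rs by (auto simp: ut_def scalar_prod_def)
    also have "\<dots> = 0"
    proof (rule sum.neutral, rule ballI)
      fix k assume "k \<in> {0..<n}"
      then show "X $$ (r, k) * Y $$ (k, s) = 0"
        using XY rs by (cases "r \<le> k") (auto simp: ut_def)
    qed
    finally show ?thesis .
  qed
  have car: "X \<in> carrier_mat n n" "Y \<in> carrier_mat n n" using assms by (auto simp: ut_def)
  then show ?thesis
    using cl[OF assms] cl[OF assms(2,1)] by (auto simp: ut_def lie_bracket_def)
qed

lemma y_mat_ut: "\<gamma> \<in> pos_roots n \<Longrightarrow> y_mat n \<gamma> \<in> ut n"
  by (auto simp: pos_roots_def ut_def y_mat_def split: prod.splits)

lemma canonical_form_dual:
  "canonical_form n S c \<in> dual_space (ut_vs n :: ('a :: field, 'a mat) module)"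
proof -
  have idx: "i - Suc 0 < n" "j - Suc 0 < n" if "(j, i) \<in> pos_roots n" for i j
    using that by (auto simp: pos_roots_def)
  have add: "canonical_form n S c (X + Y) = canonical_form n S c X + canonical_form n S c Y"
    if "X \<in> ut n" "Y \<in> ut n" for X Y :: "'a mat"
  proof -
    have "(X + Y) $$ (i - 1, j - 1) = X $$ (i - 1, j - 1) + Y $$ (i - 1, j - 1)"
      if "(j, i) \<in> pos_roots n" for i j
      using idx[OF that] \<open>X \<in> ut n\<close> \<open>Y \<in> ut n\<close> by (auto simp: ut_def)
    then show ?thesis
      unfolding canonical_form_def sum.distrib[symmetric]
      by (intro sum.cong refl) (simp only: split_paired_all prod.case distrib_left)
  qed
  have smult: "canonical_form n S c (a \<cdot>\<^sub>m X) = a * canonical_form n S c X"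
    if "X \<in> ut n" for a and X :: "'a mat"
  proof -
    have "(a \<cdot>\<^sub>m X) $$ (i - 1, j - 1) = a * X $$ (i - 1, j - 1)"
      if "(j, i) \<in> pos_roots n" for i j
      using idx[OF that] \<open>X \<in> ut n\<close> by (auto simp: ut_def)
    then show ?thesis
      unfolding canonical_form_def sum_distrib_left
      by (intro sum.cong refl) (simp only: split_paired_all prod.case mult.left_commute)
  qed
  show ?thesis
    using add smult
    by (auto simp: dual_space_def LinearCombinations.module_hom_def field_vs_def ut_vs_def module_mat_simps)
qed

lemma canonical_form_y_mat:
  assumes "\<gamma> \<in> pos_roots n"
  shows "canonical_form n S c (y_mat n \<gamma>) = (if \<gamma> \<in> A_of n S then c_ext S c \<gamma> else 0)"
proof -
  have e: "(y_mat n \<gamma> :: 'a mat) $$ (i - 1, j - 1) = (if (j, i) = \<gamma> then 1 else 0)"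
    if "(j, i) \<in> pos_roots n" for i j
    using that assms by (cases \<gamma>) (auto simp: y_mat_def pos_roots_def)
  have "canonical_form n S c (y_mat n \<gamma>) =
      (\<Sum>\<beta> \<in> pos_roots n. if \<beta> = \<gamma> then (if \<gamma> \<in> A_of n S then c_ext S c \<gamma> else 0) else 0)"
    unfolding canonical_form_def by (rule sum.cong[OF refl]) (use e in \<open>force split: prod.splits\<close>)
  also have "\<dots> = (if \<gamma> \<in> A_of n S then c_ext S c \<gamma> else 0)"
    using assms by (simp add: finite_pos_roots)
  finally show ?thesis .
qed

end

theory Submission
  imports Defs
begin

text \<open>
  The stages \<open>A\<^sub>i\<close>, and hence the symbols \<open>+\<close> and \<open>-\<close>, depend only on \<open>S\<^sub>\<otimes>\<close>: processing a root of
  \<open>S\<^sub>\<box>\<close> removes nothing. So it suffices to walk through the positive roots in decreasing order,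
  to branch only on whether a root with nonempty \<open>C(\<xi>, A)\<close> belongs to \<open>S\<^sub>\<otimes>\<close>, and to put into
  \<open>S\<^sub>\<box>\<close> every root that can be put there. For \<open>n = 7\<close> this leaves 117 cases.

  In each case let \<open>(\<delta>\<^sub>1, \<gamma>\<^sub>1), (\<delta>\<^sub>2, \<gamma>\<^sub>2), \<dots>\<close> be the pairs from \<open>C\<^sub>+ \<times> C\<^sub>-\<close> with sum in \<open>S\<^sub>\<otimes>\<close>, in the
  order in which they are removed. The matrix \<open>f([y\<^bsub>\<delta>\<^esub>, y\<^bsub>\<gamma>\<^esub>])\<close> with rows \<open>\<delta>\<^sub>k\<close> and columns \<open>\<gamma>\<^sub>k\<close> turns out
  to be triangular with nonzero diagonal \<open>c(\<delta>\<^sub>k + \<gamma>\<^sub>k)\<close>. Hence a vector orthogonal to \<open>\<pp>\<^sub>S\<close> has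
  no component along the \<open>y\<^bsub>\<gamma>\<^esub>\<close>, which makes the isotropic space \<open>\<pp>\<^sub>S\<close> maximal. That
  \<open>\<pp>\<^sub>S\<close> is an isotropic subalgebra is a condition on triples of indices; it fails only for
  \<open>S\<degree>\<close>, because of \<open>[y\<^sub>5\<^sub>4, y\<^sub>6\<^sub>5]\<close>, and there exchanging the roles of \<open>y\<^sub>5\<^sub>4\<close> and \<open>y\<^sub>7\<^sub>5\<close> repairs it.
\<close>

section \<open>Subspaces spanned by matrix units\<close>

text \<open>Adding \<alpha>_jt and \<alpha>_ti cancels \<epsilon>_t, so sums of roots can be tested
  on shared indices alone, by evaluation.\<close>

definition sum_notin :: "posroot \<Rightarrow> posroot \<Rightarrow> posroot set \<Rightarrow> bool" where
  "sum_notin \<alpha> \<beta> S \<longleftrightarrow>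
     (snd \<alpha> = fst \<beta> \<longrightarrow> (fst \<alpha>, snd \<beta>) \<notin> S) \<and> (snd \<beta> = fst \<alpha> \<longrightarrow> (fst \<beta>, snd \<alpha>) \<notin> S)"

definition sum_in :: "posroot \<Rightarrow> posroot \<Rightarrow> posroot set \<Rightarrow> bool" where
  "sum_in \<alpha> \<beta> S \<longleftrightarrow>
     (snd \<alpha> = fst \<beta> \<and> (fst \<alpha>, snd \<beta>) \<in> S) \<or> (snd \<beta> = fst \<alpha> \<and> (fst \<beta>, snd \<alpha>) \<in> S)"

text \<open>
  The pairs are listed so that the row of \<open>\<delta>\<close> meets no column \<open>\<gamma>'\<close> of a \<^emph>\<open>later\<close> pair.
\<close>

fun triangular :: "posroot set \<Rightarrow> (posroot \<times> posroot) list \<Rightarrow> bool" where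
  "triangular S [] \<longleftrightarrow> True"
| "triangular S ((\<delta>, \<gamma>) # ps) \<longleftrightarrow> (\<forall>(\<delta>', \<gamma>') \<in> set ps. sum_notin \<delta> \<gamma>' S) \<and> triangular S ps"

definition entry :: "'a mat \<Rightarrow> posroot \<Rightarrow> 'a" where
  "entry X = (\<lambda>(j, i). X $$ (i - 1, j - 1))"

definition coord_space :: "nat \<Rightarrow> posroot set \<Rightarrow> 'a :: field mat set" where
  "coord_space n P = {X \<in> ut n. \<forall>\<xi> \<in> pos_roots n - P. entry X \<xi> = 0}"

definition linear_form :: "nat \<Rightarrow> (posroot \<Rightarrow> 'a :: field) \<Rightarrow> 'a mat \<Rightarrow> 'a" where
  "linear_form n g X = (\<Sum>\<xi> \<in> pos_roots n. g \<xi> * entry X \<xi>)"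

lemma entry_y_mat:
  assumes "\<xi> \<in> pos_roots n" "\<gamma> \<in> pos_roots n"
  shows "entry (y_mat n \<gamma> :: 'a :: field mat) \<xi> = of_bool (\<xi> = \<gamma>)"
  using assms by (cases \<xi>; cases \<gamma>) (auto simp: entry_def y_mat_def pos_roots_def)

lemma entry_linear:
  assumes "X \<in> ut n" "Y \<in> ut n" "\<xi> \<in> pos_roots n"
  shows "entry (X + Y) \<xi> = entry X \<xi> + entry Y \<xi>" "entry (X - Y) \<xi> = entry X \<xi> - entry Y \<xi>"
    "entry (a \<cdot>\<^sub>m X) \<xi> = a * entry X \<xi>"
  using assms by (auto simp: entry_def pos_roots_def ut_def)

lemma ut_eqI:
  assumes "X \<in> ut n" "Y \<in> ut n" "\<And>\<xi>. \<xi> \<in> pos_roots n \<Longrightarrow> entry X \<xi> = entry Y \<xi>"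
  shows "X = Y"
proof (rule eq_matI)
  fix r s assume rs: "r < dim_row Y" "s < dim_col Y"
  then have "r < n" "s < n" using assms by (auto simp: ut_def)
  then show "X $$ (r, s) = Y $$ (r, s)"
    using assms(3)[of "(Suc s, Suc r)"] assms(1,2)
    by (cases "r \<le> s") (auto simp: ut_def entry_def pos_roots_def)
qed (use assms in \<open>auto simp: ut_def\<close>)

lemma ut_closed:
  assumes "X \<in> ut n" "Y \<in> ut n"
  shows "X + Y \<in> ut n" "X - Y \<in> ut n" "a \<cdot>\<^sub>m X \<in> ut n"
  using assms by (auto simp: ut_def)

lemma coord_space_submodule:
  "submodule class_ring (coord_space n P) (ut_vs n :: ('a :: field, 'a mat) module)"
proof -
  have "module class_ring (ut_vs n :: ('a, 'a mat) module)"
    using ut_vs_vectorspace[where n = n and 'a = 'a] by (simp add: vectorspace_def)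
  moreover have "entry (0\<^sub>m n n :: 'a mat) \<xi> = 0" if "\<xi> \<in> pos_roots n" for \<xi>
    using that by (auto simp: entry_def pos_roots_def)
  moreover have "0\<^sub>m n n \<in> ut n" by (simp add: ut_def)
  ultimately show ?thesis
    by (auto simp: submodule_def ut_vs_def module_mat_simps coord_space_def ut_closed entry_linear)
qed

text \<open>This trades spans for vanishing conditions on entries, the form in which brackets and
  isotropy are computed.\<close>

lemma coord_space_span:
  assumes "P \<subseteq> pos_roots n"
  shows "mat_span n (y_mat n ` P) = (coord_space n P :: 'a :: field mat set)"
proof -
  interpret V: vectorspace class_ring "ut_vs n :: ('a, 'a mat) module" by (rule ut_vs_vectorspace)
  have yP: "y_mat n ` P \<subseteq> carrier (ut_vs n :: ('a, 'a mat) module)"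
    using assms y_mat_ut by (auto simp: ut_vs_def)
  let ?sp = "V.span (y_mat n ` P)"
  have sub: "submodule class_ring ?sp (ut_vs n)" using V.span_is_submodule[OF yP] .
  have "?sp \<subseteq> coord_space n P"
    by (intro V.span_is_subset coord_space_submodule)
      (use assms in \<open>auto simp: coord_space_def y_mat_ut entry_y_mat subset_iff\<close>)
  \<comment> \<open>Passing from P to finite subsets Q permits induction: subtracting its component
    along y_\<gamma> moves X from \<open>insert \<gamma> Q\<close> to Q.\<close>
  moreover have "X \<in> ?sp" if "finite Q" "Q \<subseteq> P" "X \<in> coord_space n Q" for X Q
    using that
  proof (induction Q arbitrary: X rule: finite_induct)
    case empty
    then have "X = 0\<^sub>m n n"
      by (intro ut_eqI[of _ n]) (auto simp: coord_space_def ut_def entry_def pos_roots_def)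
    then show ?case using sub by (simp add: submodule_def ut_vs_def module_mat_simps)
  next
    case (insert \<gamma> Q)
    have \<gamma>: "\<gamma> \<in> pos_roots n" using insert.prems assms by auto
    let ?y = "entry X \<gamma> \<cdot>\<^sub>m y_mat n \<gamma> :: 'a mat"
    have X: "X \<in> ut n" using insert.prems by (simp add: coord_space_def)
    have y: "?y \<in> ut n" using y_mat_ut[OF \<gamma>] ut_closed by blast
    have X': "X - ?y \<in> ut n" using ut_closed(2)[OF X y] .
    have "X - ?y \<in> coord_space n Q"
      using X' X y y_mat_ut[OF \<gamma>, where 'a = 'a] insert.prems \<gamma>
      by (auto simp: coord_space_def entry_linear entry_y_mat)
    then have 1: "X - ?y \<in> ?sp" using insert by auto
    have "y_mat n \<gamma> \<in> ?sp" using V.in_own_span[OF yP] insert.prems by auto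
    then have 2: "?y \<in> ?sp" using sub by (simp add: submodule_def ut_vs_def module_mat_simps)
    have "(X - ?y) + ?y \<in> ?sp" using 1 2 sub by (simp add: submodule_def ut_vs_def module_mat_simps)
    moreover have "(X - ?y) + ?y = X"
      using X X' y ut_closed(1)[OF X' y] by (intro ut_eqI[of _ n]) (simp_all add: entry_linear)
    ultimately show ?case by simp
  qed
  ultimately show ?thesis
    using finite_subset[OF assms finite_pos_roots] by (auto simp: mat_span_def)
qed

section \<open>The bracket in coordinates\<close>

lemma entry_mult:
  assumes "X \<in> ut n" "Y \<in> ut n" "(j, i) \<in> pos_roots n"
  shows "entry (X * Y) (j, i) = (\<Sum>t \<in> {j<..<i}. entry X (t, i) * entry Y (j, t))"
proof -
  have ij: "1 \<le> j" "j < i" "i \<le> n" using assms by (auto simp: pos_roots_def)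
  have "entry (X * Y) (j, i) = (\<Sum>k = 0..<n. X $$ (i - 1, k) * Y $$ (k, j - 1))"
    using assms ij by (auto simp: entry_def ut_def scalar_prod_def)
  also have "\<dots> = (\<Sum>k \<in> {j..<i - 1}. X $$ (i - 1, k) * Y $$ (k, j - 1))"
  proof (rule sum.mono_neutral_right)
    \<comment> \<open>Outside this range one of the two strictly lower triangular factors has a zero
      entry.\<close>
    show "\<forall>k \<in> {0..<n} - {j..<i - 1}. X $$ (i - 1, k) * Y $$ (k, j - 1) = 0"
    proof
      fix k assume k: "k \<in> {0..<n} - {j..<i - 1}"
      then consider "k \<le> j - 1" | "i - 1 \<le> k" by fastforce
      then show "X $$ (i - 1, k) * Y $$ (k, j - 1) = 0"
        using assms(1,2) ij k by cases (auto simp: ut_def)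
    qed
  qed (use ij in auto)
  also have "\<dots> = (\<Sum>t \<in> {j<..<i}. entry X (t, i) * entry Y (j, t))"
    \<comment> \<open>Matrix positions start at 0, so position k is the middle index t = k +
      1.\<close>
    by (rule sum.reindex_bij_witness[of _ "\<lambda>t. t - 1" Suc]) (auto simp: entry_def)
  finally show ?thesis .
qed

lemma entry_bracket:
  assumes "X \<in> ut n" "Y \<in> ut n" "(j, i) \<in> pos_roots n"
  shows "entry (lie_bracket X Y) (j, i) =
    (\<Sum>t \<in> {j<..<i}. entry X (t, i) * entry Y (j, t) - entry Y (t, i) * entry X (j, t))"
proof -
  have "entry (lie_bracket X Y) (j, i) = entry (X * Y) (j, i) - entry (Y * X) (j, i)"
    using assms by (auto simp: entry_def lie_bracket_def ut_def pos_roots_def)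
  then show ?thesis
    using assms by (simp add: entry_mult sum_subtractf)
qed

text \<open>A chain records a relation \<alpha>_jt + \<alpha>_ti = \<alpha>_ji; these triples index
  the nonzero structure constants.\<close>

definition root_chains :: "nat \<Rightarrow> (nat \<times> nat \<times> nat) set" where
  "root_chains n = {(j, t, i). 1 \<le> j \<and> j < t \<and> t < i \<and> i \<le> n}"

lemma finite_root_chains: "finite (root_chains n)"
  by (rule finite_subset[of _ "{..n} \<times> {..n} \<times> {..n}"]) (auto simp: root_chains_def)

lemma linear_form_bracket:
  assumes "X \<in> ut n" "Y \<in> ut n"
  shows "linear_form n g (lie_bracket X Y) = (\<Sum>(j, t, i) \<in> root_chains n.
    g (j, i) * (entry X (t, i) * entry Y (j, t) - entry Y (t, i) * entry X (j, t)))"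
proof -
  have "linear_form n g (lie_bracket X Y) = (\<Sum>(j, i) \<in> pos_roots n. \<Sum>t \<in> {j<..<i}.
      g (j, i) * (entry X (t, i) * entry Y (j, t) - entry Y (t, i) * entry X (j, t)))"
    unfolding linear_form_def
    by (rule sum.cong) (auto simp: entry_bracket[OF assms] sum_distrib_left)
  also have "\<dots> = (\<Sum>((j, i), t) \<in> (SIGMA (j, i) : pos_roots n. {j<..<i}).
      g (j, i) * (entry X (t, i) * entry Y (j, t) - entry Y (t, i) * entry X (j, t)))"
    by (subst sum.Sigma[symmetric]) (auto simp: finite_pos_roots case_prod_unfold)
  also have "\<dots> = (\<Sum>(j, t, i) \<in> root_chains n.
      g (j, i) * (entry X (t, i) * entry Y (j, t) - entry Y (t, i) * entry X (j, t)))"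
    by (rule sum.reindex_bij_witness[of _ "\<lambda>(j, t, i). ((j, i), t)" "\<lambda>((j, i), t). (j, t, i)"])
      (auto simp: root_chains_def pos_roots_def)
  finally show ?thesis .
qed

lemma canonical_form_linear_form:
  "canonical_form n S c = linear_form n (\<lambda>\<xi>. if \<xi> \<in> A_of n S then c_ext S c \<xi> else 0)"
  unfolding canonical_form_def linear_form_def entry_def fun_eq_iff
  by (intro allI sum.cong) auto

section \<open>Maximality by triangular elimination\<close>

text \<open>When the form is applied to [y_\<delta>, X], the coordinate of X at \<eta> occurs only
  with coefficient g(\<delta> + \<eta>), up to sign. The hypothesis \<open>other\<close> kills every
  \<eta> but \<gamma>, so one term remains, and its coefficient is nonzero.\<close>

lemma bracket_y_mat_pivot:
  assumes X: "X \<in> ut n" and \<delta>: "\<delta> \<in> pos_roots n" and \<gamma>: "\<gamma> \<in> pos_roots n"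
    and "sum_in \<delta> \<gamma> {\<xi>. g \<xi> \<noteq> 0}"
    and other: "\<And>\<eta>. \<eta> \<in> pos_roots n \<Longrightarrow> \<eta> \<noteq> \<gamma> \<Longrightarrow> entry X \<eta> = 0 \<or> sum_notin \<delta> \<eta> {\<xi>. g \<xi> \<noteq> 0}"
    and "linear_form n g (lie_bracket (y_mat n \<delta>) X) = 0"
  shows "entry X \<gamma> = 0"
proof -
  define F where "F = (\<lambda>(j, t, i). g (j, i) *
      (entry (y_mat n \<delta>) (t, i) * entry X (j, t) - entry X (t, i) * entry (y_mat n \<delta>) (j, t)))"
  have zero: "(\<Sum>\<tau> \<in> root_chains n. F \<tau>) = 0"
    using assms(6) unfolding linear_form_bracket[OF y_mat_ut[OF \<delta>] X] F_def .
  have pr: "(j, t) \<in> pos_roots n" "(t, i) \<in> pos_roots n" if "(j, t, i) \<in> root_chains n" for j t i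
    using that by (auto simp: root_chains_def pos_roots_def)
  have F: "F (j, t, i) = g (j, i) * (of_bool ((t, i) = \<delta>) * entry X (j, t) - entry X (t, i) * of_bool ((j, t) = \<delta>))"
    if "(j, t, i) \<in> root_chains n" for j t i
    using pr[OF that] \<delta> by (simp add: F_def entry_y_mat)
  \<comment> \<open>A summand can survive only if one half of its chain is \<delta>; unless the
    other half is \<gamma>, it is covered by \<open>other\<close>.\<close>
  have van: "F (j, t, i) = 0" if c: "(j, t, i) \<in> root_chains n"
    and "\<not> ((t, i) = \<delta> \<and> (j, t) = \<gamma>)" "\<not> ((j, t) = \<delta> \<and> (t, i) = \<gamma>)" for j t i
    using F[OF c] other[OF pr(1)[OF c]] other[OF pr(2)[OF c]] that(2,3) by (auto simp: sum_notin_def)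
  have single: "F \<tau> = 0" if "\<tau> \<in> root_chains n" "\<And>\<sigma>. \<sigma> \<in> root_chains n \<Longrightarrow> \<sigma> \<noteq> \<tau> \<Longrightarrow> F \<sigma> = 0" for \<tau>
    using zero that finite_root_chains by (simp add: sum.remove[of _ \<tau>])
  consider a b d where "\<delta> = (a, b)" "\<gamma> = (b, d)" "g (a, d) \<noteq> 0"
    | a b d where "\<gamma> = (a, b)" "\<delta> = (b, d)" "g (a, d) \<noteq> 0"
    using assms(4) by (cases \<delta>; cases \<gamma>) (auto simp: sum_in_def)
  then show ?thesis
  proof cases
    case 1
    then have c: "(a, b, d) \<in> root_chains n" using \<delta> \<gamma> by (auto simp: root_chains_def pos_roots_def)
    have "F (a, b, d) = 0"
      using single[OF c] van 1 \<delta> \<gamma> by (auto simp: root_chains_def pos_roots_def)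
    then show ?thesis using F[OF c] 1 c by (auto simp: root_chains_def)
  next
    case 2
    then have c: "(a, b, d) \<in> root_chains n" using \<delta> \<gamma> by (auto simp: root_chains_def pos_roots_def)
    have "F (a, b, d) = 0"
      using single[OF c] van 2 \<delta> \<gamma> by (auto simp: root_chains_def pos_roots_def)
    then show ?thesis using F[OF c] 2 c by (auto simp: root_chains_def)
  qed
qed

text \<open>Forward elimination: triangularity clears the later columns from the first row, so the
  pivot coordinate of that row vanishes. It then joins the known zeros, which is why the hypothesis
  on the remaining roots is a disjunction.\<close>

lemma triangular_vanish:
  assumes "X \<in> ut n" "set ps \<subseteq> pos_roots n \<times> pos_roots n" "triangular S ps"
    and supp: "\<And>\<xi>. g \<xi> \<noteq> 0 \<Longrightarrow> \<xi> \<in> S"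
    and "\<And>\<delta> \<gamma>. (\<delta>, \<gamma>) \<in> set ps \<Longrightarrow> sum_in \<delta> \<gamma> {\<xi>. g \<xi> \<noteq> 0} \<and>
           linear_form n g (lie_bracket (y_mat n \<delta>) X) = 0"
    and "\<And>\<delta> \<gamma> \<eta>. (\<delta>, \<gamma>) \<in> set ps \<Longrightarrow> \<eta> \<in> pos_roots n \<Longrightarrow> \<eta> \<notin> snd ` set ps \<Longrightarrow>
           entry X \<eta> = 0 \<or> sum_notin \<delta> \<eta> S"
    and "\<gamma> \<in> snd ` set ps"
  shows "entry X \<gamma> = 0"
  using assms(2,3,5,6,7)
proof (induction ps arbitrary: \<gamma>)
  case (Cons p ps)
  obtain \<delta> \<gamma>0 where p: "p = (\<delta>, \<gamma>0)" by (cases p)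
  have mono: "sum_notin \<alpha> \<beta> {\<xi>. g \<xi> \<noteq> 0}" if "sum_notin \<alpha> \<beta> S" for \<alpha> \<beta>
    using that supp by (auto simp: sum_notin_def)
  have p0: "\<delta> \<in> pos_roots n" "\<gamma>0 \<in> pos_roots n" "sum_in \<delta> \<gamma>0 {\<xi>. g \<xi> \<noteq> 0}"
    "linear_form n g (lie_bracket (y_mat n \<delta>) X) = 0"
    using Cons.prems(1) Cons.prems(3)[of \<delta> \<gamma>0] by (simp_all add: p)
  have head: "entry X \<gamma>0 = 0"
  proof (rule bracket_y_mat_pivot[OF assms(1), of \<delta> \<gamma>0 g])
    fix \<eta> assume \<eta>: "\<eta> \<in> pos_roots n" "\<eta> \<noteq> \<gamma>0"
    show "entry X \<eta> = 0 \<or> sum_notin \<delta> \<eta> {\<xi>. g \<xi> \<noteq> 0}"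
    proof (cases "\<eta> \<in> snd ` set ps")
      case True
      then have "sum_notin \<delta> \<eta> S" using Cons.prems(2) by (auto simp: p)
      then show ?thesis using mono[of \<delta> \<eta>] by simp
    next
      case False
      then show ?thesis using Cons.prems(4)[of \<delta> \<gamma>0 \<eta>] \<eta> mono[of \<delta> \<eta>] by (auto simp: p)
    qed
  qed (rule p0)+
  show ?case
  proof (cases "\<gamma> = \<gamma>0")
    case False
    show ?thesis
    proof (rule Cons.IH)
      fix \<delta>' \<gamma>' \<eta> assume "(\<delta>', \<gamma>') \<in> set ps" "\<eta> \<in> pos_roots n" "\<eta> \<notin> snd ` set ps"
      then show "entry X \<eta> = 0 \<or> sum_notin \<delta>' \<eta> S"
        using Cons.prems(4)[of \<delta>' \<gamma>' \<eta>] head by (cases "\<eta> = \<gamma>0") (auto simp: p)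
    qed (use Cons.prems False in \<open>auto simp: p\<close>)
  qed (use head in simp)
qed simp

text \<open>Closure of P under sums gives the subalgebra, sums avoiding S give isotropy. For
  maximality, an element of a larger isotropic space is orthogonal to every y_\<delta> with \<delta>
  in P, and \<open>triangular_vanish\<close> applies.\<close>

lemma polarization_coord_space:
  fixes g :: "posroot \<Rightarrow> 'a :: field"
  assumes P: "P = pos_roots n - snd ` set ps"
    and ps: "set ps \<subseteq> P \<times> pos_roots n" "triangular S ps"
    and closed: "\<And>j t i. (j, t) \<in> P \<Longrightarrow> (t, i) \<in> P \<Longrightarrow> (j, i) \<in> P \<and> (j, i) \<notin> S"
    and supp: "\<And>\<xi>. g \<xi> \<noteq> 0 \<Longrightarrow> \<xi> \<in> S"
    and pivot: "\<And>\<delta> \<gamma>. (\<delta>, \<gamma>) \<in> set ps \<Longrightarrow> sum_in \<delta> \<gamma> {\<xi>. g \<xi> \<noteq> 0}"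
  shows "polarization (ut_vs n) lie_bracket (linear_form n g) (mat_span n (y_mat n ` P))"
proof -
  let ?p = "coord_space n P :: 'a mat set"
  have span: "mat_span n (y_mat n ` P) = ?p"
    by (rule coord_space_span) (auto simp: P)
  have ut: "X \<in> ut n" if "X \<in> ?p" for X using that by (simp add: coord_space_def)
  have sub: "VectorSpace.subspace class_ring ?p (ut_vs n)"
    using coord_space_submodule[of n P] ut_vs_vectorspace[where n = n and 'a = 'a]
    by (simp add: VectorSpace.subspace_def)
  \<comment> \<open>By contraposition of \<open>closed\<close>, one half of the chain lies outside
    P. Both the subalgebra property and isotropy follow from this.\<close>
  have prod_zero: "entry X (t, i) * entry Y (j, t) = 0"
    if "X \<in> ?p" "Y \<in> ?p" "1 \<le> j" "j < t" "t < i" "i \<le> n" "(j, i) \<notin> P \<or> (j, i) \<in> S" for X Y j t i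
  proof (cases "(j, t) \<in> P \<and> (t, i) \<in> P")
    case False
    moreover have "(j, t) \<in> pos_roots n" "(t, i) \<in> pos_roots n"
      using that by (auto simp: pos_roots_def)
    ultimately show ?thesis using that(1,2) by (auto simp: coord_space_def)
  qed (use that(7) closed[of j t i] in blast)
  have "lie_bracket X Y \<in> ?p" if "X \<in> ?p" "Y \<in> ?p" for X Y
  proof -
    have "entry (lie_bracket X Y) (j, i) = 0" if "(j, i) \<in> pos_roots n - P" for j i
      using that \<open>X \<in> ?p\<close> \<open>Y \<in> ?p\<close>
      by (subst entry_bracket[OF ut ut, of _ _ j i]) (auto intro!: sum.neutral simp: prod_zero pos_roots_def)
    then show ?thesis
      using ut_lie_bracket[OF ut[OF that(1)] ut[OF that(2)]] by (auto simp: coord_space_def)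
  qed
  moreover have "linear_form n g (lie_bracket X Y) = 0" if "X \<in> ?p" "Y \<in> ?p" for X Y
    unfolding linear_form_bracket[OF ut[OF that(1)] ut[OF that(2)]]
  proof (rule sum.neutral, safe)
    fix j t i assume c: "(j, t, i) \<in> root_chains n"
    show "g (j, i) * (entry X (t, i) * entry Y (j, t) - entry Y (t, i) * entry X (j, t)) = 0"
      using prod_zero[OF that, of j t i] prod_zero[OF that(2,1), of j t i] supp[of "(j, i)"] c
      by (cases "g (j, i) = 0") (auto simp: root_chains_def)
  qed
  moreover have "W = ?p" if W: "isotropic_subspace (ut_vs n) lie_bracket (linear_form n g) W" "?p \<subseteq> W" for W
  proof (intro antisym W(2) subsetI)
    fix X assume X: "X \<in> W"
    have "W \<subseteq> ut n"
      using W(1) by (auto simp: isotropic_subspace_def VectorSpace.subspace_def submodule_def ut_vs_def)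
    then have Xut: "X \<in> ut n" using X by auto
    have "entry X \<gamma> = 0" if "\<gamma> \<in> snd ` set ps" for \<gamma>
    proof (rule triangular_vanish[OF Xut _ ps(2) supp _ _ that])
      fix \<delta> \<gamma> assume d: "(\<delta>, \<gamma>) \<in> set ps"
      then have "\<delta> \<in> P" using ps by auto
      then have "y_mat n \<delta> \<in> ?p"
        using P by (auto simp: coord_space_def y_mat_ut entry_y_mat)
      then have "linear_form n g (lie_bracket (y_mat n \<delta>) X) = 0"
        using W X by (auto simp: isotropic_subspace_def)
      then show "sum_in \<delta> \<gamma> {\<xi>. g \<xi> \<noteq> 0} \<and> linear_form n g (lie_bracket (y_mat n \<delta>) X) = 0"
        using pivot[OF d] by simp
      fix \<eta> assume "\<eta> \<in> pos_roots n" "\<eta> \<notin> snd ` set ps"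
      then have "\<eta> \<in> P" using P by auto
      then show "entry X \<eta> = 0 \<or> sum_notin \<delta> \<eta> S"
        using \<open>\<delta> \<in> P\<close> closed by (cases \<delta>; cases \<eta>) (auto simp: sum_notin_def)
    qed (use ps P in auto)
    then show "X \<in> ?p" using Xut P by (auto simp: coord_space_def)
  qed
  ultimately show ?thesis
    using sub unfolding span
    by (auto simp: polarization_def lie_subalgebra_def isotropic_subspace_def)
qed

section \<open>Enumeration of admissible subsets\<close>

definition roots :: "nat \<Rightarrow> posroot list" where
  "roots n = concat (map (\<lambda>j. map (Pair j) (rev [Suc j..<Suc n])) [1..<Suc n])"

lemma set_roots: "set (roots n) = pos_roots n"
proof -
  have "set (roots n) = (\<Union>j\<in>{1..<Suc n}. Pair j ` {Suc j..<Suc n})"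
    unfolding roots_def set_concat set_map image_image set_rev set_upt ..
  also have "\<dots> = pos_roots n"
    by (auto simp: pos_roots_def image_iff)
  finally show ?thesis .
qed

lemma sorted_roots: "sorted_wrt root_gt (roots n)"
proof -
  have row: "sorted_wrt root_gt (map (Pair j) (rev [Suc j..<Suc n]))" for j
    by (simp add: sorted_wrt_map root_gt_def sorted_wrt_rev del: upt_Suc)
  have "sorted_wrt root_gt (concat (map (\<lambda>j. map (Pair j) (rev [Suc j..<Suc n])) xs))"
    if "sorted_wrt (<) xs" for xs
    using that
  proof (induction xs)
    case (Cons k xs)
    have "root_gt \<alpha> \<beta>" if "\<alpha> \<in> Pair k ` X" "\<beta> \<in> (\<Union>j\<in>set xs. Pair j ` Y j)" for \<alpha> \<beta> X Y
      using that Cons.prems by (auto simp: root_gt_def)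
    then show ?case
      using Cons row[of k] by (simp add: sorted_wrt_append del: upt_Suc)
  qed simp
  then show ?thesis
    unfolding roots_def using sorted_wrt_upt by blast
qed

text \<open>A strictly decreasing enumeration is unique, so the definite description can be replaced
  by a computable list.\<close>

lemma desc_list_filter:
  assumes "S \<subseteq> pos_roots n"
  shows "desc_list S = filter (\<lambda>\<xi>. \<xi> \<in> S) (roots n)"
proof -
  have "finite S" using assms finite_pos_roots finite_subset by blast
  moreover have "set (filter (\<lambda>\<xi>. \<xi> \<in> S) (roots n)) = S"
    using assms by (auto simp: set_roots)
  moreover have "sorted_wrt root_gt (filter (\<lambda>\<xi>. \<xi> \<in> S) (roots n))"
    by (simp add: sorted_roots sorted_wrt_filter)
  ultimately show ?thesis
    unfolding desc_list_def by (intro the1_equality desc_list_ex1) auto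
qed

lemma length_desc_list:
  assumes "S \<subseteq> pos_roots n"
  shows "length (desc_list S) = card S"
proof -
  have "distinct xs" if "sorted_wrt root_gt xs" for xs
    using that by (induction xs) (auto simp: root_gt_def)
  then have "distinct (desc_list S)"
    using sorted_roots desc_list_filter[OF assms] by simp
  moreover have "set (desc_list S) = S"
    using desc_list_filter[OF assms] assms set_roots by auto
  ultimately show ?thesis
    using distinct_card by metis
qed

section \<open>Decompositions of a root into two roots\<close>

text \<open>The half starting at the smaller index is the greater root, so first components form C_+
  and second ones C_-. The value t = \<open>fst \<xi>\<close> drops out when A consists of positive
  roots.\<close>

definition splits :: "posroot \<Rightarrow> posroot list \<Rightarrow> (posroot \<times> posroot) list" where
  "splits \<xi> A = map (\<lambda>t. ((fst \<xi>, t), (t, snd \<xi>)))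
     (filter (\<lambda>t. (fst \<xi>, t) \<in> set A \<and> (t, snd \<xi>) \<in> set A) [fst \<xi>..<snd \<xi>])"

lemma root_vec_split:
  assumes "t < s" "a < b"
  shows "root_vec (j, i) - root_vec (t, s) = root_vec (a, b) \<longleftrightarrow>
    (t = j \<and> s = a \<and> b = i) \<or> (a = j \<and> b = t \<and> s = i)"
    (is "?L \<longleftrightarrow> ?R")
proof
  assume L: ?L
  have e: "(of_bool (l = j) - of_bool (l = i)) - (of_bool (l = t) - of_bool (l = s)) =
      (of_bool (l = a) - of_bool (l = b) :: int)" for l
    using fun_cong[OF L, of l] by (simp add: root_vec_def eps_def of_bool_def)
  \<comment> \<open>The coefficient 1 at the smaller of t and a can only come from \<xi>; for t = a
    it would have to be 2, which \<xi> does not have.\<close>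
  consider "t < a" | "a < t" | "t = a" by linarith
  then show ?R
  proof cases
    case 1
    then have "t = j" using e[of t] assms by (simp add: of_bool_def split: if_splits)
    moreover from this have "a = s" using e[of a] assms 1 by (simp add: of_bool_def split: if_splits)
    ultimately show ?thesis using e[of b] assms by (simp add: of_bool_def split: if_splits)
  next
    case 2
    then have "a = j" using e[of a] assms by (simp add: of_bool_def split: if_splits)
    moreover from this have "t = b" using e[of t] assms 2 by (simp add: of_bool_def split: if_splits)
    ultimately show ?thesis using e[of s] assms by (simp add: of_bool_def split: if_splits)
  next
    case 3
    then show ?thesis using e[of t] assms by (simp add: of_bool_def split: if_splits)
  qed
next
  assume ?R then show ?L
    by (elim disjE conjE) (simp_all add: root_vec_def fun_eq_iff)
qed

lemma splits_iff:
  assumes "set A \<subseteq> pos_roots n"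
  shows "(\<gamma>, \<delta>) \<in> set (splits \<xi> A) \<longleftrightarrow>
    \<gamma> \<in> set A \<and> \<delta> \<in> set A \<and> root_vec \<xi> - root_vec \<gamma> = root_vec \<delta> \<and> root_gt \<gamma> \<delta>"
proof -
  obtain j i t s a b where p: "\<xi> = (j, i)" "\<gamma> = (t, s)" "\<delta> = (a, b)"
    by (cases \<xi>; cases \<gamma>; cases \<delta>)
  show ?thesis
  proof (cases "\<gamma> \<in> set A \<and> \<delta> \<in> set A")
    case True
    then have o: "t < s" "a < b" using assms by (auto simp: p pos_roots_def)
    show ?thesis
      using True o unfolding p root_vec_split[OF o]
      by (simp add: splits_def root_gt_def image_iff) (rule iffI; elim conjE disjE; simp)
  qed (auto simp: p splits_def)
qed

lemma C_plus_splits: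
  assumes "set A \<subseteq> pos_roots n"
  shows "C_plus \<xi> (set A) = fst ` set (splits \<xi> A)"
proof (rule Set.set_eqI)
  fix \<gamma>
  have "\<gamma> \<in> C_plus \<xi> (set A) \<longleftrightarrow> (\<exists>\<delta>. (\<gamma>, \<delta>) \<in> set (splits \<xi> A))"
    unfolding splits_iff[OF assms] C_plus_def by blast
  then show "\<gamma> \<in> C_plus \<xi> (set A) \<longleftrightarrow> \<gamma> \<in> fst ` set (splits \<xi> A)" by force
qed

lemma C_minus_splits:
  assumes "set A \<subseteq> pos_roots n"
  shows "C_minus \<xi> (set A) = snd ` set (splits \<xi> A)"
proof (rule Set.set_eqI)
  fix \<gamma>
  have "root_vec \<xi> - root_vec \<gamma> = root_vec \<delta> \<longleftrightarrow> root_vec \<xi> - root_vec \<delta> = root_vec \<gamma>" for \<delta>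
    by (simp add: fun_eq_iff diff_eq_eq add.commute)
  then have "\<gamma> \<in> C_minus \<xi> (set A) \<longleftrightarrow> (\<exists>\<delta>. (\<delta>, \<gamma>) \<in> set (splits \<xi> A))"
    unfolding splits_iff[OF assms] C_minus_def by blast
  then show "\<gamma> \<in> C_minus \<xi> (set A) \<longleftrightarrow> \<gamma> \<in> snd ` set (splits \<xi> A)" by force
qed

section \<open>Branching over the possible sets S_otimes\<close>

definition reduce :: "posroot \<Rightarrow> posroot list \<Rightarrow> posroot list" where
  "reduce \<xi> A = filter (\<lambda>\<gamma>. \<gamma> \<notin> fst ` set (splits \<xi> A) \<and> \<gamma> \<notin> snd ` set (splits \<xi> A)) A"

fun trace :: "posroot list \<Rightarrow> posroot list \<Rightarrow> (posroot \<times> posroot list) list" where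
  "trace A [] = []"
| "trace A (\<xi> # xs) = (\<xi>, A) # trace (reduce \<xi> A) xs"

text \<open>
  \<open>Q\<close> is tested on the resulting \<open>S\<^sub>\<otimes>\<close>, the largest possible \<open>S\<^sub>\<box>\<close>, and the pairs \<open>(\<gamma>, \<xi> - \<gamma>)\<close> with
  \<open>\<gamma>\<close> marked \<open>+\<close> and \<open>\<xi> - \<gamma>\<close> marked \<open>-\<close>.
\<close>

fun search :: "(posroot list \<Rightarrow> posroot list \<Rightarrow> (posroot \<times> posroot) list \<Rightarrow> bool) \<Rightarrow> posroot list \<Rightarrow>
    posroot list \<Rightarrow> posroot list \<Rightarrow> posroot list \<Rightarrow> (posroot \<times> posroot) list \<Rightarrow> bool" where
  "search Q [] A Ot Bx ps \<longleftrightarrow> Q Ot Bx ps"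
| "search Q (\<xi> # L) A Ot Bx ps \<longleftrightarrow>
     (if \<xi> \<notin> set A then search Q L A Ot Bx ps
      else if splits \<xi> A = [] then search Q L A Ot (Bx @ [\<xi>]) ps
      else search Q L A Ot Bx ps \<and> search Q L (reduce \<xi> A) (Ot @ [\<xi>]) Bx (ps @ splits \<xi> A))"


definition otimes_of :: "(posroot \<times> posroot list) list \<Rightarrow> posroot list" where
  "otimes_of T = map fst (filter (\<lambda>(\<xi>, A). splits \<xi> A \<noteq> []) T)"

definition pairs_of :: "(posroot \<times> posroot list) list \<Rightarrow> (posroot \<times> posroot) list" where
  "pairs_of T = concat (map (\<lambda>(\<xi>, A). splits \<xi> A) T)"

text \<open>An admissible S singles out one branch. A root outside A cannot lie in S; a box leaves A
  unchanged and is collected whether or not it lies in S; any other root is decided by membership in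
  S. The leaf reached has the S_otimes and the pairs of S, and at least its boxes.\<close>

lemma search_sound:
  assumes "search Q L A Ot Bx ps" and "\<forall>(\<xi>, B) \<in> set (trace A (filter (\<lambda>\<xi>. \<xi> \<in> S) L)). \<xi> \<in> set B"
  shows "\<exists>Bx'. Q (Ot @ otimes_of (trace A (filter (\<lambda>\<xi>. \<xi> \<in> S) L))) Bx'
        (ps @ pairs_of (trace A (filter (\<lambda>\<xi>. \<xi> \<in> S) L))) \<and>
      set Bx \<subseteq> set Bx' \<and>
      (\<forall>(\<xi>, B) \<in> set (trace A (filter (\<lambda>\<xi>. \<xi> \<in> S) L)). splits \<xi> B = [] \<longrightarrow> \<xi> \<in> set Bx')"
  using assms
proof (induction L arbitrary: A Ot Bx ps)
  case Nil
  then show ?case by (auto simp: otimes_of_def pairs_of_def)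
next
  case (Cons \<xi> L)
  consider (skip) "\<xi> \<notin> set A" | (box) "\<xi> \<in> set A" "splits \<xi> A = []"
    | (out) "\<xi> \<in> set A" "splits \<xi> A \<noteq> []" "\<xi> \<notin> S" | (otimes) "\<xi> \<in> set A" "splits \<xi> A \<noteq> []" "\<xi> \<in> S"
    by blast
  then show ?case
  proof cases
    case skip
    then show ?thesis using Cons.IH[of A Ot Bx ps] Cons.prems by (auto split: if_splits)
  next
    case box
    then have "reduce \<xi> A = A" by (simp add: reduce_def)
    moreover have "search Q L A Ot (Bx @ [\<xi>]) ps" using box Cons.prems(1) by simp
    ultimately show ?thesis
      using Cons.IH[of A Ot "Bx @ [\<xi>]" ps] Cons.prems(2) box
      by (cases "\<xi> \<in> S") (auto simp: otimes_of_def pairs_of_def)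
  next
    case out
    then show ?thesis using Cons.IH[of A Ot Bx ps] Cons.prems by auto
  next
    case otimes
    then show ?thesis
      using Cons.IH[of "reduce \<xi> A" "Ot @ [\<xi>]" Bx "ps @ splits \<xi> A"] Cons.prems
      by (auto simp: otimes_of_def pairs_of_def)
  qed
qed

lemma set_reduce:
  assumes "set A \<subseteq> pos_roots n"
  shows "set (reduce \<xi> A) = set A - C_set \<xi> (set A)"
  unfolding C_set_split(1)[OF assms] C_plus_splits[OF assms] C_minus_splits[OF assms]
  by (auto simp: reduce_def)

section \<open>Stages and diagram read off from lists\<close>

lemma A_stage_subset: "A_stage n S r \<subseteq> pos_roots n"
  by (induction r) auto

lemma set_fold_reduce:
  assumes "r \<le> length (desc_list S)"
  shows "set (fold reduce (take r (desc_list S)) (roots n)) = A_stage n S r"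
  using assms
proof (induction r)
  case (Suc r)
  then show ?case
    using set_reduce[where n = n] A_stage_subset[of n S r] by (simp add: take_Suc_conv_app_nth)
qed (simp add: set_roots)

text \<open>Links the recursion that the search follows with stages indexed by r.\<close>

lemma trace_eq: "trace A xs = map (\<lambda>r. (xs ! r, fold reduce (take r xs) A)) [0..<length xs]"
proof (induction xs arbitrary: A)
  case (Cons x xs)
  then show ?case
    by (simp add: upt_conv_Cons map_Suc_upt[symmetric] del: upt_Suc)
qed simp

definition S_trace :: "nat \<Rightarrow> posroot set \<Rightarrow> (posroot \<times> posroot list) list" where
  "S_trace n S = trace (roots n) (desc_list S)"

lemma S_trace_ex:
  assumes "S \<subseteq> pos_roots n"
  shows "(\<exists>r < card S. Q (desc_list S ! r) (A_stage n S r)) \<longleftrightarrow> (\<exists>(\<xi>, A) \<in> set (S_trace n S). Q \<xi> (set A))"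
  unfolding S_trace_def trace_eq using length_desc_list[OF assms] set_fold_reduce[of _ S n]
  by auto

lemma S_trace_all:
  assumes "S \<subseteq> pos_roots n"
  shows "(\<forall>r < card S. Q (desc_list S ! r) (A_stage n S r)) \<longleftrightarrow> (\<forall>(\<xi>, A) \<in> set (S_trace n S). Q \<xi> (set A))"
  using S_trace_ex[OF assms, of "\<lambda>\<xi> A. \<not> Q \<xi> A"] by auto

lemma S_trace_subset:
  assumes "S \<subseteq> pos_roots n" "(\<xi>, A) \<in> set (S_trace n S)"
  shows "set A \<subseteq> pos_roots n"
  using S_trace_all[OF assms(1), of "\<lambda>\<xi> A. A \<subseteq> pos_roots n"] A_stage_subset assms(2) by auto

lemma admissible_S_trace:
  "admissible n S \<longleftrightarrow> S \<subseteq> pos_roots n \<and> (\<forall>(\<xi>, A) \<in> set (S_trace n S). \<xi> \<in> set A)"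
  unfolding admissible_def using S_trace_all[of S n "\<lambda>\<xi> A. \<xi> \<in> A"] by blast

lemma C_set_empty_splits:
  assumes "set A \<subseteq> pos_roots n"
  shows "C_set \<xi> (set A) = {} \<longleftrightarrow> splits \<xi> A = []"
  unfolding C_set_split(1)[OF assms] C_plus_splits[OF assms] C_minus_splits[OF assms] by simp

lemma S_otimes_S_trace:
  assumes "S \<subseteq> pos_roots n"
  shows "S_otimes n S = set (otimes_of (S_trace n S))"
proof -
  have C: "C_set \<eta> (set A) = {} \<longleftrightarrow> splits \<eta> A = []" if "(\<eta>, A) \<in> set (S_trace n S)" for \<eta> A
    using C_set_empty_splits[OF S_trace_subset[OF assms that]] .
  have "\<xi> \<in> S_otimes n S \<longleftrightarrow> (\<exists>(\<eta>, A) \<in> set (S_trace n S). \<xi> = \<eta> \<and> C_set \<eta> (set A) \<noteq> {})" for \<xi>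
    unfolding S_otimes_def S_trace_ex[OF assms, symmetric, of "\<lambda>\<eta> A. \<xi> = \<eta> \<and> C_set \<eta> A \<noteq> {}"] by blast
  also have "\<dots> \<xi> \<longleftrightarrow> (\<exists>(\<eta>, A) \<in> set (S_trace n S). \<xi> = \<eta> \<and> splits \<eta> A \<noteq> [])" for \<xi>
    by (intro bex_cong refl) (simp add: C case_prod_unfold)
  finally have "S_otimes n S = {\<xi>. \<exists>A. (\<xi>, A) \<in> set (S_trace n S) \<and> splits \<xi> A \<noteq> []}" by auto
  also have "\<dots> = set (otimes_of (S_trace n S))" by (force simp: otimes_of_def)
  finally show ?thesis .
qed

lemma S_box_S_trace:
  assumes "S \<subseteq> pos_roots n"
  shows "S_box n S = {\<xi>. \<exists>A. (\<xi>, A) \<in> set (S_trace n S) \<and> splits \<xi> A = []}"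
proof -
  have C: "C_set \<eta> (set A) = {} \<longleftrightarrow> splits \<eta> A = []" if "(\<eta>, A) \<in> set (S_trace n S)" for \<eta> A
    using C_set_empty_splits[OF S_trace_subset[OF assms that]] .
  have "\<xi> \<in> S_box n S \<longleftrightarrow> (\<exists>(\<eta>, A) \<in> set (S_trace n S). \<xi> = \<eta> \<and> C_set \<eta> (set A) = {})" for \<xi>
    unfolding S_box_def S_trace_ex[OF assms, symmetric, of "\<lambda>\<eta> A. \<xi> = \<eta> \<and> C_set \<eta> A = {}"] by blast
  also have "\<dots> \<xi> \<longleftrightarrow> (\<exists>(\<eta>, A) \<in> set (S_trace n S). \<xi> = \<eta> \<and> splits \<eta> A = [])" for \<xi>
    by (intro bex_cong refl) (simp add: C case_prod_unfold)
  finally show ?thesis by auto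
qed

lemma S_eq_otimes_box:
  assumes "S \<subseteq> pos_roots n"
  shows "S = S_otimes n S \<union> S_box n S"
proof -
  have "set (desc_list S) = S"
    using desc_list_filter[OF assms] assms set_roots by auto
  then have "S = {desc_list S ! r | r. r < card S}"
    unfolding length_desc_list[OF assms, symmetric] set_conv_nth[symmetric] by simp
  then show ?thesis unfolding S_otimes_def S_box_def by blast
qed

lemma set_pairs_of: "set (pairs_of T) = (\<Union>(\<xi>, A) \<in> set T. set (splits \<xi> A))"
  by (simp add: pairs_of_def case_prod_unfold)

lemma diagram_Plus_pairs:
  assumes "S \<subseteq> pos_roots n"
  shows "(i, j) \<in> diagram n S Plus \<longleftrightarrow> (j, i) \<in> fst ` set (pairs_of (S_trace n S))"
proof -
  have C: "C_plus \<eta> (set A) = fst ` set (splits \<eta> A)" if "(\<eta>, A) \<in> set (S_trace n S)" for \<eta> A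
    using C_plus_splits[OF S_trace_subset[OF assms that]] .
  have "(i, j) \<in> diagram n S Plus \<longleftrightarrow> (\<exists>(\<xi>, A) \<in> set (S_trace n S). (j, i) \<in> C_plus \<xi> (set A))"
    using S_trace_ex[OF assms, of "\<lambda>\<xi> A. (j, i) \<in> C_plus \<xi> A"] by simp
  also have "\<dots> \<longleftrightarrow> (\<exists>(\<xi>, A) \<in> set (S_trace n S). (j, i) \<in> fst ` set (splits \<xi> A))"
    by (intro bex_cong refl) (simp add: C case_prod_unfold del: image_iff)
  finally show ?thesis unfolding set_pairs_of image_UN by (simp add: case_prod_unfold)
qed

lemma fold_reduce_pairs:
  "set (fold reduce xs A) = set A - fst ` set (pairs_of (trace A xs)) - snd ` set (pairs_of (trace A xs))"
proof (induction xs arbitrary: A)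
  case (Cons x xs)
  have "set (pairs_of (trace A (x # xs))) = set (splits x A) \<union> set (pairs_of (trace (reduce x A) xs))"
    by (simp add: pairs_of_def)
  moreover have "set (reduce x A) = set A - fst ` set (splits x A) - snd ` set (splits x A)"
    unfolding reduce_def set_filter by blast
  ultimately show ?case
    using Cons[of "reduce x A"] unfolding fold_simps comp_apply by (simp only: image_Un) blast
qed (simp add: pairs_of_def)

lemma A_of_pairs:
  assumes "S \<subseteq> pos_roots n"
  shows "A_of n S = pos_roots n - fst ` set (pairs_of (S_trace n S)) - snd ` set (pairs_of (S_trace n S))"
  using fold_reduce_pairs[of "desc_list S" "roots n"] set_fold_reduce[of "card S" S n]
  by (simp add: A_of_def S_trace_def length_desc_list[OF assms] set_roots)

text \<open>Every root lies in S or M(S), or was removed with + or -. If neither a root of S nor a +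
  root also carries -, the basis is the complement of the - roots.\<close>

lemma p_basis_pairs:
  assumes "S \<subseteq> pos_roots n" and "ps = pairs_of (S_trace n S)"
    and "\<forall>\<xi> \<in> S. \<xi> \<notin> snd ` set ps" and "\<forall>(\<delta>, \<gamma>) \<in> set ps. \<delta> \<notin> snd ` set ps"
  shows "p_basis n S = y_mat n ` (pos_roots n - snd ` set ps)"
proof -
  have disj: "fst ` set ps \<inter> snd ` set ps = {}" using assms(4) by fastforce
  have *: "(\<exists>s \<in> {Plus, Otimes, Box, Bullet}. (i, j) \<in> diagram n S s) \<longleftrightarrow> (j, i) \<notin> snd ` set ps"
    if "(j, i) \<in> pos_roots n" for i j
  proof -
    have "(\<exists>s \<in> {Plus, Otimes, Box, Bullet}. (i, j) \<in> diagram n S s) \<longleftrightarrow>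
        (j, i) \<in> fst ` set ps \<or> (j, i) \<in> S \<or> (j, i) \<in> A_of n S - S"
      using diagram_Plus_pairs[OF assms(1)] S_eq_otimes_box[OF assms(1)] assms(2)
      by (auto simp: M_of_def simp del: diagram.simps(4))
    also have "\<dots> \<longleftrightarrow> (j, i) \<notin> snd ` set ps"
      using that assms(3) disj unfolding A_of_pairs[OF assms(1)] assms(2)[symmetric] by blast
    finally show ?thesis .
  qed
  have "X \<in> p_basis n S \<longleftrightarrow> (\<exists>j i. X = y_mat n (j, i) \<and> (j, i) \<in> pos_roots n - snd ` set ps)"
    for X :: "'a :: field mat"
    unfolding p_basis_def using * by blast
  then show ?thesis
    unfolding image_def Bex_def split_paired_Ex by blast
qed

text \<open>
  \<open>S\<close> may contain superfluous roots: only the roots in \<open>Ot\<close> are required to have a nonzero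
  coefficient.
\<close>

definition certified :: "nat \<Rightarrow> posroot list \<Rightarrow> posroot list \<Rightarrow> (posroot \<times> posroot) list \<Rightarrow> bool" where
  "certified n Ot S ps \<longleftrightarrow> (let P = filter (\<lambda>\<eta>. \<eta> \<notin> snd ` set ps) (roots n) in
     (\<forall>(\<delta>, \<gamma>) \<in> set ps. \<delta> \<in> set P \<and> \<gamma> \<in> set (roots n) \<and> sum_in \<delta> \<gamma> (set Ot)) \<and>
     (\<forall>\<alpha> \<in> set P. \<forall>\<beta> \<in> set P. snd \<alpha> = fst \<beta> \<longrightarrow> (fst \<alpha>, snd \<beta>) \<in> set P \<and> (fst \<alpha>, snd \<beta>) \<notin> set S) \<and>
     triangular (set S) ps)"

section \<open>The exceptional set and the evaluation of all cases\<close>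

definition circ_otimes :: "posroot list" where
  "circ_otimes = [(1, 4), (2, 5), (3, 7), (4, 7)]"

definition circ_boxes :: "posroot list" where
  "circ_boxes = [(4, 6), (5, 6)]"

text \<open>The first condition makes every chosen root survive into A(S), so that the form takes
  the value of c there. The exceptional case is recognized by S_otimes; fixing its boxes lets
  maximality identify S.\<close>

definition leaf :: "nat \<Rightarrow> posroot list \<Rightarrow> posroot list \<Rightarrow> (posroot \<times> posroot) list \<Rightarrow> bool" where
  "leaf n Ot Bx ps \<longleftrightarrow>
     (\<forall>\<xi> \<in> set (Ot @ Bx). \<xi> \<notin> fst ` set ps \<and> \<xi> \<notin> snd ` set ps) \<and>
     (if n = 7 \<and> Ot = circ_otimes then Bx = circ_boxes else certified n Ot (Ot @ Bx) ps)"

lemma search_leaf: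
  assumes "n \<le> 7"
  shows "search (leaf n) (roots n) (roots n) [] [] []"
proof -
  have "search (leaf 7) (roots 7) (roots 7) [] [] []"
    by code_simp
  moreover have "list_all (\<lambda>n. search (leaf n) (roots n) (roots n) [] [] []) [0..<7]"
    by code_simp
  ultimately show ?thesis
    using assms by (cases "n = 7") (auto simp: list_all_iff)
qed

text \<open>The pairs of S\<degree> except the last one, with sum \<alpha>_47, which has to be
  turned round.\<close>

definition circ_pairs :: "(posroot \<times> posroot) list" where
  "circ_pairs = [((1, 2), (2, 4)), ((1, 3), (3, 4)), ((2, 3), (3, 5)), ((3, 6), (6, 7))]"

lemma S_circ_trace:
  "list_all (\<lambda>(\<xi>, A). \<xi> \<in> set A) (S_trace 7 S_circ)"
  "otimes_of (S_trace 7 S_circ) = circ_otimes"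
  "pairs_of (S_trace 7 S_circ) = circ_pairs @ [((4, 5), (5, 7))]"
proof -
  have "S_circ \<subseteq> pos_roots 7" by (simp add: S_circ_def pos_roots_def)
  then have T: "S_trace 7 S_circ = trace (roots 7) (filter (\<lambda>\<xi>. \<xi> \<in> S_circ) (roots 7))"
    by (simp add: S_trace_def desc_list_filter)
  show "list_all (\<lambda>(\<xi>, A). \<xi> \<in> set A) (S_trace 7 S_circ)" unfolding T by code_simp
  show "otimes_of (S_trace 7 S_circ) = circ_otimes" unfolding T by code_simp
  show "pairs_of (S_trace 7 S_circ) = circ_pairs @ [((4, 5), (5, 7))]" unfolding T by code_simp
qed

text \<open>With the last pair turned round, \<alpha>_45 is among the excluded roots, so \<alpha>_45
  + \<alpha>_56 = \<alpha>_46, a root of S\<degree>, no longer obstructs isotropy.\<close>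

lemma certified_circ:
  "certified 7 circ_otimes (circ_otimes @ circ_boxes) (circ_pairs @ [((5, 7), (4, 5))])"
  by code_simp

section \<open>From certificates to polarizations\<close>

lemma polarization_certified:
  fixes g :: "posroot \<Rightarrow> 'a :: field"
  assumes "certified n Ot B ps"
    and "\<And>\<xi>. g \<xi> \<noteq> 0 \<Longrightarrow> \<xi> \<in> set B" "\<And>\<xi>. \<xi> \<in> set Ot \<Longrightarrow> g \<xi> \<noteq> 0"
  shows "polarization (ut_vs n) lie_bracket (linear_form n g)
    (mat_span n (y_mat n ` (pos_roots n - snd ` set ps)))"
proof (rule polarization_coord_space[OF refl])
  let ?P = "pos_roots n - snd ` set ps"
  have P: "set (filter (\<lambda>\<eta>. \<eta> \<notin> snd ` set ps) (roots n)) = ?P"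
    by (auto simp: set_roots)
  note c = assms(1)[unfolded certified_def Let_def P set_roots]
  show "set ps \<subseteq> ?P \<times> pos_roots n" "triangular (set B) ps" using c by auto
  show "(j, i) \<in> ?P \<and> (j, i) \<notin> set B" if "(j, t) \<in> ?P" "(t, i) \<in> ?P" for j t i
  proof -
    have "\<forall>\<alpha> \<in> ?P. \<forall>\<beta> \<in> ?P. snd \<alpha> = fst \<beta> \<longrightarrow> (fst \<alpha>, snd \<beta>) \<in> ?P \<and> (fst \<alpha>, snd \<beta>) \<notin> set B"
      using c by blast
    from this[rule_format, OF that] show ?thesis by simp
  qed
  show "sum_in \<delta> \<gamma> {\<xi>. g \<xi> \<noteq> 0}" if "(\<delta>, \<gamma>) \<in> set ps" for \<delta> \<gamma>
  proof -
    have "sum_in \<delta> \<gamma> (set Ot)" using c that by auto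
    then show ?thesis using assms(3) by (auto simp: sum_in_def)
  qed
qed (fact assms(2))

text \<open>Lets the removal of a matrix from the basis be read as the removal of its root.\<close>

lemma inj_on_y_mat: "inj_on (y_mat n :: posroot \<Rightarrow> 'a :: field mat) (pos_roots n)"
proof (rule inj_onI)
  fix \<xi> \<eta> assume "\<xi> \<in> pos_roots n" "\<eta> \<in> pos_roots n" "(y_mat n \<xi> :: 'a mat) = y_mat n \<eta>"
  then show "\<xi> = \<eta>"
    using entry_y_mat[of \<xi> n \<xi>, where 'a = 'a] entry_y_mat[of \<xi> n \<eta>, where 'a = 'a]
    by (simp split: if_splits)
qed

theorem theorem1p12:
  fixes n :: nat and S :: "posroot set"
  assumes "n \<le> 7" and "maximal_admissible n S"
  shows "(\<not> (n = 7 \<and> S = S_circ) \<longrightarrow>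
            (\<forall>c :: posroot \<Rightarrow> 'a :: field_char_0. maximal_admissible_pair n S c \<longrightarrow>
               polarization (ut_vs n) lie_bracket (canonical_form n S c) (p_space n S))) \<and>
         (n = 7 \<and> S = S_circ \<longrightarrow>
            (\<forall>c :: posroot \<Rightarrow> 'a. maximal_admissible_pair n S c \<longrightarrow>
               polarization (ut_vs n) lie_bracket (canonical_form n S c)
                 (mat_span n ((p_basis n S - {y_mat n (4, 5)}) \<union> {y_mat n (5, 7)}))))"
proof -
  have adm: "admissible n S" using assms(2) by (simp add: maximal_admissible_def)
  then have S: "S \<subseteq> pos_roots n" by (simp add: admissible_def)
  define Ot ps where "Ot = otimes_of (S_trace n S)" and "ps = pairs_of (S_trace n S)"
  have "S_trace n S = trace (roots n) (filter (\<lambda>\<xi>. \<xi> \<in> S) (roots n))"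
    by (simp add: S_trace_def desc_list_filter[OF S])
  then obtain Bx where leaf: "leaf n Ot Bx ps"
    and "\<forall>(\<xi>, B) \<in> set (S_trace n S). splits \<xi> B = [] \<longrightarrow> \<xi> \<in> set Bx"
    using search_sound[OF search_leaf[OF assms(1)], of S] adm
    unfolding admissible_S_trace Ot_def ps_def by auto
  then have box: "S_box n S \<subseteq> set Bx"
    unfolding S_box_S_trace[OF S] by auto
  have otimes: "S_otimes n S = set Ot"
    using S_otimes_S_trace[OF S] by (simp add: Ot_def)
  have sub: "S \<subseteq> set (Ot @ Bx)"
    using S_eq_otimes_box[OF S] box otimes by auto
  have disj: "\<forall>\<xi> \<in> S. \<xi> \<notin> fst ` set ps \<and> \<xi> \<notin> snd ` set ps"
    using leaf sub unfolding leaf_def by blast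
  \<comment> \<open>The list is arbitrary, to serve both for the pairs of the diagram and for the
    modified pairs of S\<degree>.\<close>
  have pol: "polarization (ut_vs n) lie_bracket (canonical_form n S c)
      (mat_span n (y_mat n ` (pos_roots n - snd ` set qs)))"
    if "certified n Ot (Ot @ Bx) qs" "maximal_admissible_pair n S c"
    for qs and c :: "posroot \<Rightarrow> 'a"
    unfolding canonical_form_linear_form
  proof (rule polarization_certified[OF that(1)])
    show "\<xi> \<in> set (Ot @ Bx)" if "(if \<xi> \<in> A_of n S then c_ext S c \<xi> else 0) \<noteq> 0" for \<xi>
    proof -
      have "\<xi> \<in> S" using that by (simp add: c_ext_def split: if_splits)
      then show ?thesis using sub by blast
    qed
    fix \<xi> assume \<xi>: "\<xi> \<in> set Ot"
    then have "\<xi> \<in> S" using S_eq_otimes_box[OF S] otimes by blast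
    moreover from this have "\<xi> \<in> A_of n S"
      using S disj unfolding A_of_pairs[OF S] ps_def[symmetric] by blast
    moreover have "c \<xi> \<noteq> 0"
      using that(2) \<xi> otimes by (simp add: maximal_admissible_pair_def)
    ultimately show "(if \<xi> \<in> A_of n S then c_ext S c \<xi> else 0) \<noteq> 0"
      by (simp add: c_ext_def)
  qed
  show ?thesis
  proof (cases "n = 7 \<and> Ot = circ_otimes")
    case False
    then have cert: "certified n Ot (Ot @ Bx) ps" using leaf by (simp add: leaf_def)
    then have "\<forall>(\<delta>, \<gamma>) \<in> set ps. \<delta> \<notin> snd ` set ps" by (auto simp: certified_def Let_def)
    then have "p_space n S = mat_span n (y_mat n ` (pos_roots n - snd ` set ps) :: 'a mat set)"
      using p_basis_pairs[OF S ps_def, where 'a = 'a] disj by (simp add: p_space_def)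
    then have "\<forall>c :: posroot \<Rightarrow> 'a. maximal_admissible_pair n S c \<longrightarrow>
        polarization (ut_vs n) lie_bracket (canonical_form n S c) (p_space n S)"
      using pol[OF cert] by simp
    \<comment> \<open>S\<degree> has S_otimes given by \<open>circ_otimes\<close>, so in this case
      only the first claim is at issue.\<close>
    moreover have "\<not> (n = 7 \<and> S = S_circ)"
      using False S_circ_trace(2) by (auto simp: Ot_def)
    ultimately show ?thesis by blast
  next
    case True
    then have n: "n = 7" and Ot: "Ot = circ_otimes" by simp_all
    have Bx: "Bx = circ_boxes" using leaf unfolding leaf_def if_P[OF True] by blast
    have circ: "S_circ \<subseteq> pos_roots 7" by (simp add: S_circ_def pos_roots_def)
    have "admissible 7 S_circ"
      using circ S_circ_trace(1) by (simp add: admissible_S_trace list_all_iff)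
    moreover have ot: "S_otimes 7 S_circ = S_otimes n S"
      using S_circ_trace(2) Ot by (simp add: S_otimes_S_trace[OF circ] otimes)
    moreover have "S_box n S \<subseteq> S_box 7 S_circ"
    proof -
      have "set Bx \<subseteq> S_circ - set Ot" by (simp add: Bx Ot circ_boxes_def circ_otimes_def S_circ_def)
      then show ?thesis using S_eq_otimes_box[OF circ] ot otimes box by blast
    qed
    \<comment> \<open>Maximality of S enters: S\<degree> is admissible with the same S_otimes and at
      least the boxes of S, so the boxes agree.\<close>
    ultimately have "S_box 7 S_circ = S_box n S"
      using assms(2) unfolding maximal_admissible_def n by blast
    then have SC: "S = S_circ" using S_eq_otimes_box[OF circ] S_eq_otimes_box[OF S] ot by simp
    have ps: "ps = circ_pairs @ [((4, 5), (5, 7))]"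
      using S_circ_trace(3) by (simp add: ps_def n SC)
    let ?P = "pos_roots 7 - snd ` set ps"
    have "\<forall>(\<delta>, \<gamma>) \<in> set ps. \<delta> \<notin> snd ` set ps" by (simp add: ps circ_pairs_def)
    then have "p_basis n S = (y_mat n ` ?P :: 'a mat set)"
      using p_basis_pairs[OF S ps_def, where 'a = 'a] disj by (simp add: n)
    moreover have "y_mat n ` (?P - {(4, 5)}) = (y_mat n ` ?P - y_mat n ` {(4, 5)} :: 'a mat set)"
      unfolding n by (rule inj_on_image_set_diff[OF inj_on_y_mat]) (auto simp: pos_roots_def)
    ultimately have "p_basis n S - {y_mat n (4, 5)} \<union> {y_mat n (5, 7)} =
        (y_mat n ` (?P - {(4, 5)} \<union> {(5, 7)}) :: 'a mat set)"
      by (simp add: image_Un)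
    \<comment> \<open>Replacing y_54 by y_75 amounts to turning the last pair round, which gives the
      list of \<open>certified_circ\<close>.\<close>
    also have "?P - {(4, 5)} \<union> {(5, 7)} =
        pos_roots 7 - snd ` set (circ_pairs @ [((5, 7), (4, 5))])"
    proof -
      have "(5, 7) \<in> pos_roots 7" by (simp add: pos_roots_def)
      then show ?thesis by (auto simp: ps circ_pairs_def)
    qed
    finally show ?thesis
      using pol[of "circ_pairs @ [((5, 7), (4, 5))]"] certified_circ by (simp add: n SC Ot Bx)
  qed
qed

end
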